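(* Let $p$ be an odd prime, let $F$ be a field, and let $D$ be a cyclic division algebra of degree $p$ over $F$. Then $D$ is not Amitsur-Small.
   Context: A cyclic algebra $D=(K/F,\beta)$ of degree $n$ over a field $F$ is the (central simple, $n^2$-dimensional) $F$-algebra generated by two elements $i$ and $j$ such that $K=F[i]$ is a cyclic Galois field extension of $F$ of degree $n$ with Galois group $\langle\sigma\rangle$, $j t j^{-1}=\sigma(t)$ for every $t\in F[i]$, and $j^n=\beta\in F^\times$. A cyclic division algebra is a cyclic algebra that is a division ring; its center is $F$. For a division ring $D$ with center $F$, the polynomial ring is $D[x_1,\dots,x_n]=D\otimes_F F[x_1,\dots,x_n]$, so the variables $x_1,\dots,x_n$ are central (they commute with each other and with all elements of $D$). A division ring $D$ is called Amitsur-Small if for every $n\geq 2$ and every maximal left ideal $I$ of $D[x_1,\dots,x_n]$, the intersection $I\cap D[x_1,\dots,x_{n-1}]$ is a maximal left ideal of $D[x_1,\dots,x_{n-1}]$. *)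

theory Defs
  imports Complex_Main "HOL-Library.Poly_Mapping" "HOL-Computational_Algebra.Primes"
begin

definition left_ideal :: "'a::ring_1 set \<Rightarrow> 'a set \<Rightarrow> bool" where
  "left_ideal R I \<longleftrightarrow> I \<subseteq> R \<and> 0 \<in> I \<and> (\<forall>x\<in>I. \<forall>y\<in>I. x + y \<in> I) \<and> (\<forall>r\<in>R. \<forall>x\<in>I. r * x \<in> I)"

definition maximal_left_ideal :: "'a::ring_1 set \<Rightarrow> 'a set \<Rightarrow> bool" where
  "maximal_left_ideal R I \<longleftrightarrow>
     left_ideal R I \<and> I \<noteq> R \<and> (\<forall>J. left_ideal R J \<and> I \<subseteq> J \<longrightarrow> J = I \<or> J = R)"

text \<open>
  The type \<open>(nat \<Rightarrow>\<^sub>0 nat) \<Rightarrow>\<^sub>0 'd\<close>, with its convolution product, is the ring of polynomials with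
  coefficients in \<open>'d\<close> in countably many central variables: a monomial is its finitely supported
  exponent vector.  The ring \<open>D[x\<^sub>1,\<dots>,x\<^sub>n]\<close> is the subring of the polynomials all of whose
  monomials involve only variables with index in \<open>{1..n}\<close>, so that \<open>D[x\<^sub>1,\<dots>,x\<^sub>m]\<close> is literally a
  subset of \<open>D[x\<^sub>1,\<dots>,x\<^sub>n]\<close> for \<open>m \<le> n\<close>.
\<close>

definition polys :: "nat \<Rightarrow> ((nat \<Rightarrow>\<^sub>0 nat) \<Rightarrow>\<^sub>0 'd::ring_1) set" where
  "polys n = {P. \<forall>m \<in> Poly_Mapping.keys P. Poly_Mapping.keys m \<subseteq> {1..n}}"

lemma one_in_polys: "1 \<in> polys n"
  by (simp add: polys_def)

lemma uminus_in_polys: "P \<in> polys n \<Longrightarrow> - P \<in> polys n"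
  by (simp add: polys_def)

lemma add_in_polys:
  assumes "P \<in> polys n" "Q \<in> polys n"
  shows "P + Q \<in> polys n"
  using assms Poly_Mapping.keys_add[of P Q] by (fastforce simp: polys_def)

lemma mult_in_polys:
  assumes "P \<in> polys n" "Q \<in> polys n"
  shows "P * Q \<in> polys n"
  unfolding polys_def
proof (intro CollectI ballI)
  fix m assume "m \<in> Poly_Mapping.keys (P * Q)"
  then obtain a b where ab: "m = a + b" "a \<in> Poly_Mapping.keys P" "b \<in> Poly_Mapping.keys Q"
    using keys_mult[of P Q] by blast
  then have "Poly_Mapping.keys a \<subseteq> {1..n}" "Poly_Mapping.keys b \<subseteq> {1..n}"
    using assms by (auto simp: polys_def)
  then show "Poly_Mapping.keys m \<subseteq> {1..n}"
    using Poly_Mapping.keys_add[of a b] ab(1) by blast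
qed

text \<open>Being Amitsur-Small is a property of a division ring, here the type \<open>'d\<close>.\<close>

definition amitsur_small :: "'d::division_ring itself \<Rightarrow> bool" where
  "amitsur_small _ \<longleftrightarrow>
     (\<forall>n\<ge>2. \<forall>I :: ((nat \<Rightarrow>\<^sub>0 nat) \<Rightarrow>\<^sub>0 'd) set.
        maximal_left_ideal (polys n) I \<longrightarrow>
        maximal_left_ideal (polys (n - 1)) (I \<inter> polys (n - 1)))"

definition simple_ring :: "'a::ring_1 itself \<Rightarrow> bool" where
  "simple_ring _ \<longleftrightarrow>
     (\<forall>I :: 'a set. left_ideal UNIV I \<and> (\<forall>x\<in>I. \<forall>r. x * r \<in> I) \<longrightarrow> I = {0} \<or> I = UNIV)"

locale field_algebra = vector_space scale
  for scale :: "'f::field \<Rightarrow> 'd::ring_1 \<Rightarrow> 'd" (infixr \<open>*s\<close> 75) +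
  assumes scale_mult_left: "(a *s x) * y = a *s (x * y)"
    and scale_mult_right: "x * (a *s y) = a *s (x * y)"
begin

text \<open>The copy of \<open>F\<close> inside the algebra.\<close>

definition scalars :: "'d set" where
  "scalars = range (\<lambda>a. a *s 1)"

definition subalgebra :: "'d set \<Rightarrow> bool" where
  "subalgebra A \<longleftrightarrow> subspace A \<and> 1 \<in> A \<and> (\<forall>x\<in>A. \<forall>y\<in>A. x * y \<in> A)"

definition generated_subalgebra :: "'d set \<Rightarrow> 'd set" where
  "generated_subalgebra S = subalgebra hull S"

definition extension_field :: "'d set \<Rightarrow> bool" where
  "extension_field K \<longleftrightarrow> subalgebra K \<and> (\<forall>x\<in>K. \<forall>y\<in>K. x * y = y * x) \<and>
     (\<forall>x\<in>K. x \<noteq> 0 \<longrightarrow> (\<exists>y\<in>K. x * y = 1))"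

text \<open>Only the values of \<open>\<tau>\<close> on \<open>K\<close> matter.\<close>

definition automorphism_over :: "'d set \<Rightarrow> ('d \<Rightarrow> 'd) \<Rightarrow> bool" where
  "automorphism_over K \<tau> \<longleftrightarrow> bij_betw \<tau> K K \<and>
     (\<forall>x\<in>K. \<forall>y\<in>K. \<tau> (x + y) = \<tau> x + \<tau> y) \<and>
     (\<forall>x\<in>K. \<forall>y\<in>K. \<tau> (x * y) = \<tau> x * \<tau> y) \<and>
     (\<forall>c\<in>scalars. \<tau> c = c)"

text \<open>For \<open>K\<close> of finite degree: the fixed field of the group of all \<open>F\<close>-automorphisms is \<open>F\<close>.\<close>

definition galois_extension :: "'d set \<Rightarrow> bool" where
  "galois_extension K \<longleftrightarrow> extension_field K \<and>
     {x\<in>K. \<forall>\<tau>. automorphism_over K \<tau> \<longrightarrow> \<tau> x = x} = scalars"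

text \<open>
  For positive \<open>n\<close>, \<open>dim K = n\<close> includes finite-dimensionality, as \<open>dim\<close> is \<open>0\<close> for
  infinite-dimensional subspaces.  As the Galois group is then finite, the nonnegative powers of
  a generator exhaust it.
\<close>

definition cyclic_galois_extension :: "nat \<Rightarrow> 'd set \<Rightarrow> ('d \<Rightarrow> 'd) \<Rightarrow> bool" where
  "cyclic_galois_extension n K \<sigma> \<longleftrightarrow> galois_extension K \<and> n > 0 \<and> dim K = n \<and>
     automorphism_over K \<sigma> \<and>
     (\<forall>\<tau>. automorphism_over K \<tau> \<longrightarrow> (\<exists>k. \<forall>x\<in>K. \<tau> x = (\<sigma> ^^ k) x))"

definition central :: bool where
  "central \<longleftrightarrow> {z. \<forall>x. z * x = x * z} = scalars"

text \<open>
  The element \<open>j'\<close> is the inverse of \<open>j\<close>.  The last three conditions are the customary description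
  of a cyclic algebra as central simple of dimension \<open>n\<^sup>2\<close>; they follow from the preceding ones.
\<close>

definition cyclic_algebra :: "nat \<Rightarrow> bool" where
  "cyclic_algebra n \<longleftrightarrow> (\<exists>i j j' \<sigma> \<beta>.
     generated_subalgebra {i, j} = UNIV \<and>
     cyclic_galois_extension n (generated_subalgebra {i}) \<sigma> \<and>
     j * j' = 1 \<and> j' * j = 1 \<and>
     (\<forall>t\<in>generated_subalgebra {i}. j * t * j' = \<sigma> t) \<and>
     \<beta> \<noteq> 0 \<and> j ^ n = \<beta> *s 1 \<and>
     central \<and> simple_ring TYPE('d) \<and> dim (UNIV :: 'd set) = n\<^sup>2)"

end

end

theory Submission
  imports Defs
begin

text \<open>
  Write \<open>x\<close>, \<open>y\<close> for the two variables, \<open>K = F[i]\<close>, and \<open>i' = j i j\<inverse>\<close>, the Galois conjugate of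
  \<open>i\<close>.  Two variables suffice: a maximal left ideal of \<open>D[x, y]\<close> is found whose intersection with
  \<open>D[x]\<close> is not maximal.

  Let \<open>L\<close> be a field generated over \<open>K\<close> by an element \<open>b\<close> with \<open>b\<^sup>p = \<beta>\<close>.  On \<open>M = D \<otimes> L\<close>, tensored over
  \<open>K\<close>, let \<open>D\<close> act by left multiplication, \<open>x\<close> by right multiplication by \<open>i\<close> and \<open>y\<close> by \<open>b\<close>.  Since
  \<open>D\<close> tensored over \<open>F\<close> with \<open>K\<close> is a matrix ring over \<open>K\<close>, this is the column module
  \<open>L\<^sup>p\<close> of a matrix ring over \<open>L\<close>, which is simple, so the annihilator of \<open>v = 1 \<otimes> 1 + j \<otimes> b\<close> is a
  maximal left ideal.  If \<open>b\<close> lies outside \<open>K\<close>, then \<open>1\<close> and \<open>b\<close> are independent over \<open>K\<close>, and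
  \<open>v\<close> generates over \<open>D[x]\<close> a sum of two copies of the simple module \<open>D\<close>: a polynomial in \<open>x\<close> alone
  that kills \<open>v\<close> kills both \<open>1\<close> and \<open>j\<close>.  Its annihilator in \<open>D[x]\<close> is therefore not maximal.

  This is carried out without constructing \<open>L\<close>.  With \<open>b\<close> an indeterminate subject only to
  \<open>b\<^sup>p = \<beta>\<close>, the annihilator \<open>J\<close> of \<open>v\<close> is a proper left ideal, and Zorn's lemma puts it into a
  maximal one, \<open>I\<close>.  If \<open>I \<inter> D[x]\<close> were maximal, then some \<open>x - a\<close> would lie in it
  (\<open>maximal_left_ideal_contains_linear\<close>), because \<open>(x - i) (x - i')\<close> does.  An element of \<open>J\<close> of
  degree one in \<open>y\<close> then yields \<open>y - q \<in> I\<close> for some \<open>q \<in> D\<close>.  Comparing the two products of these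
  linear polynomials, \<open>q\<close> commutes with \<open>a\<close>, and \<open>q\<^sup>p = \<beta>\<close>.  As \<open>a\<close> is a conjugate of \<open>i\<close>, the centralizer of \<open>i\<close> contains a \<open>p\<close>-th root of
  \<open>\<beta>\<close>.  This is \<open>not_amitsur_smallI\<close>.

  The centralizer of \<open>i\<close> is \<open>K\<close> (\<open>centralizer_subset_K\<close>), so it remains to see that \<open>\<beta>\<close> has no \<open>p\<close>-th
  root \<open>t\<close> in \<open>K\<close> (\<open>no_pth_root_in_K\<close>).  For odd \<open>p\<close> such a \<open>t\<close> would have norm
  \<open>\<beta>\<close>, and then \<open>z = t\<inverse> j\<close> would satisfy \<open>z\<^sup>p = 1\<close>, which is impossible: the factor
  \<open>1 + z + \<dots> + z\<^sup>p\<^sup>-\<^sup>1\<close> of \<open>z\<^sup>p - 1\<close> would vanish although the powers of \<open>z\<close> are independent over \<open>K\<close>.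
  Oddness enters through the product \<open>\<omega>\<^sup>0 \<omega>\<^sup>1 \<dots> \<omega>\<^sup>p\<^sup>-\<^sup>1\<close> of a \<open>p\<close>-th root of unity, which is
  \<open>1\<close> for odd \<open>p\<close>; for Hamilton's quaternions, with \<open>p = 2\<close> and \<open>\<beta> = -1\<close>, the root does exist.
\<close>

section \<open>Eigenvectors and roots of unity in division rings\<close>

text \<open>
  Right multiplication by \<open>x\<close> is linear for left multiplication, and \<open>e k\<close> is an eigenvector of it
  with eigenvalue \<open>c k\<close>; this is the independence of eigenvectors for distinct eigenvalues.  It replaces
  dimension counts below.
\<close>

lemma right_eigenvectors_independent:
  fixes x :: "'d::division_ring"
  assumes "finite S"
    and "\<And>k. k \<in> S \<Longrightarrow> e k * x = c k * e k"
    and comm: "\<And>k l. k \<in> S \<Longrightarrow> l \<in> S \<Longrightarrow> c k * c l = c l * c k"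
    and inj: "inj_on c S"
    and "(\<Sum>k\<in>S. e k) = 0" and "k \<in> S"
  shows "e k = 0"
  using assms
  \<comment> \<open>Subtracting \<open>c m\<close> times the relation from its product with \<open>x\<close> eliminates \<open>e m\<close>, and
    \<open>(c l - c m) * e l\<close> is again an eigenvector because the \<open>c l\<close> commute.\<close>
proof (induction S arbitrary: e k rule: finite_induct)
  case (insert m S)
  have "(\<Sum>l\<in>S. (c l - c m) * e l) = (\<Sum>l\<in>insert m S. (c l - c m) * e l)"
    using insert.hyps by simp
  also have "\<dots> = (\<Sum>l\<in>insert m S. e l * x) - (\<Sum>l\<in>insert m S. c m * e l)"
    unfolding sum_subtractf [symmetric]
    by (intro sum.cong refl) (simp add: insert.prems(1) left_diff_distrib)
  also have "\<dots> = 0"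
    using insert.prems(4) by (simp flip: sum_distrib_left sum_distrib_right)
  finally have sum0: "(\<Sum>l\<in>S. (c l - c m) * e l) = 0" .
  have eig: "((c l - c m) * e l) * x = c l * ((c l - c m) * e l)" if "l \<in> S" for l
  proof -
    have "((c l - c m) * e l) * x = (c l - c m) * (c l * e l)"
      using insert.prems(1) that by (simp add: mult.assoc)
    also have "\<dots> = (c l * (c l - c m)) * e l"
      using insert.prems(2)[of l m] that by (simp add: algebra_simps flip: mult.assoc)
    finally show ?thesis by (simp add: mult.assoc)
  qed
  have S0: "e l = 0" if "l \<in> S" for l
  proof -
    have "(c l - c m) * e l = 0"
      by (rule insert.IH[where e = "\<lambda>l. (c l - c m) * e l"])
        (use eig sum0 that insert.prems in \<open>auto intro: inj_on_subset\<close>)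
    moreover have "c l \<noteq> c m"
      using insert.hyps(2) insert.prems(3) that by (metis insertCI inj_on_def)
    ultimately show ?thesis by simp
  qed
  then have "e m = 0"
    using insert.prems(4) insert.hyps by simp
  then show ?case
    using S0 insert.prems(5) by auto
qed simp

text \<open>Moving every \<open>t\<close> to the left past the powers of \<open>z\<close> costs \<open>0 + 1 + \<dots> + (n - 1)\<close> factors \<open>\<omega>\<close>.\<close>

lemma power_mult_power_commuting_up_to_central:
  fixes t z \<omega> :: "'d::division_ring"
  assumes "z * t = \<omega> * t * z" and central: "\<And>x. \<omega> * x = x * \<omega>"
  shows "(t * z) ^ n = \<omega> ^ (n * (n - 1) div 2) * t ^ n * z ^ n"
proof -
  have om: "\<omega> ^ k * x = x * \<omega> ^ k" for k x
    using central by (metis power_commuting_commutes)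
  have zn: "z ^ k * t = \<omega> ^ k * t * z ^ k" for k
  proof (induction k)
    case (Suc k)
    have "z ^ Suc k * t = z * (z ^ k * t)" by (simp only: power_Suc mult.assoc)
    also have "\<dots> = (z * \<omega> ^ k) * t * z ^ k" by (simp only: Suc mult.assoc)
    also have "\<dots> = \<omega> ^ k * (z * t) * z ^ k" unfolding om[of k z, symmetric] by (simp only: mult.assoc)
    also have "\<dots> = \<omega> ^ Suc k * t * z ^ Suc k"
      unfolding power_Suc2[of \<omega>] power_Suc[of z] assms(1) by (simp only: mult.assoc)
    finally show ?case .
  qed simp
  show ?thesis
  proof (induction n)
    case (Suc n)
    have exp: "Suc n * (Suc n - 1) div 2 = n * (n - 1) div 2 + n"
      by (cases n) (auto simp: algebra_simps)
    let ?e = "n * (n - 1) div 2"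
    have "(t * z) ^ Suc n = (\<omega> ^ ?e * t ^ n * z ^ n) * (t * z)"
      by (simp only: power_Suc2 Suc)
    also have "\<dots> = \<omega> ^ ?e * t ^ n * (z ^ n * t) * z" by (simp add: mult.assoc)
    also have "\<dots> = \<omega> ^ ?e * (t ^ n * \<omega> ^ n) * t * z ^ n * z"
      by (simp only: zn mult.assoc)
    also have "\<dots> = \<omega> ^ ?e * (\<omega> ^ n * t ^ n) * t * z ^ n * z"
      by (simp only: om)
    also have "\<dots> = \<omega> ^ (?e + n) * t ^ Suc n * z ^ Suc n"
      by (simp only: power_add power_Suc2 mult.assoc)
    finally show ?case by (simp only: exp)
  qed simp
qed

lemma geometric_sum_eq_0:
  fixes z :: "'d::division_ring"
  assumes "z ^ n = 1" "z \<noteq> 1"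
  shows "(\<Sum>k<n. z ^ k) = 0"
proof -
  have "(z - 1) * (\<Sum>k<n. z ^ k) = z ^ n - 1"
    by (induction n) (simp_all add: algebra_simps)
  then show ?thesis using assms by simp
qed

text \<open>
  A nontrivial central \<open>p\<close>-th root of unity \<open>\<zeta>\<close> generates all of them.  Otherwise no
  \<open>\<zeta> ^ m * \<omega>\<close> is \<open>1\<close>, so every geometric sum in \<open>\<zeta> ^ m * \<omega>\<close> vanishes; adding these over \<open>m\<close>
  leaves only the \<open>p\<close> constant terms, by orthogonality, whence \<open>p = 0\<close>.
\<close>

lemma prime_root_of_unity_generates:
  fixes \<zeta> \<omega> :: "'d::division_ring"
  assumes "prime p" and char: "of_nat p \<noteq> (0::'d)"
    and central: "\<And>x. \<zeta> * x = x * \<zeta>"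
    and "\<zeta> ^ p = 1" "\<zeta> \<noteq> 1" and "\<omega> ^ p = 1"
  shows "\<exists>m<p. \<zeta> ^ m * \<omega> = 1"
proof (rule ccontr)
  assume no: "\<not> ?thesis"
  have zp: "\<zeta> ^ m * x = x * \<zeta> ^ m" for m x
    using central by (metis power_commuting_commutes)
  have mult_power: "(\<zeta> ^ m * \<omega>) ^ l = \<zeta> ^ (m * l) * \<omega> ^ l" for m l
    using power_mult_power_commuting_up_to_central[of \<omega> "\<zeta> ^ m" 1 l] zp[of m \<omega>]
    by (simp add: power_mult)
  have v0: "(\<Sum>l<p. \<zeta> ^ (m * l) * \<omega> ^ l) = 0" if "m < p" for m
  proof -
    have "(\<zeta> ^ m * \<omega>) ^ p = 1"
      by (simp add: mult_power assms mult.commute[of m p] power_mult)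
    then show ?thesis
      using geometric_sum_eq_0[of "\<zeta> ^ m * \<omega>" p] no that by (simp add: mult_power)
  qed
  have gs: "(\<Sum>m<p. \<zeta> ^ (m * l)) = (if l = 0 then of_nat p else 0)" if "l < p" for l
  proof (cases "l = 0")
    case False
    have "\<zeta> ^ l \<noteq> 1"
    proof
      assume 1: "\<zeta> ^ l = 1"
      have "coprime l p"
        using that False \<open>prime p\<close> by (metis coprime_commute nat_dvd_not_less neq0_conv prime_imp_coprime)
      then obtain x y where xy: "l * x = p * y + 1"
        using coprime_bezout_strong[of l p] \<open>prime p\<close> prime_gt_1_nat by force
      have "\<zeta> ^ (l * x) = \<zeta> ^ (p * y) * \<zeta>" by (simp add: xy power_commutes)
      then show False using 1 assms(4,5) by (simp add: power_mult)
    qed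
    moreover have "(\<zeta> ^ l) ^ p = 1"
      by (metis assms(4) mult.commute power_mult power_one)
    ultimately show ?thesis
      using geometric_sum_eq_0[of "\<zeta> ^ l" p] False by (simp add: power_mult mult.commute[of _ l])
  qed simp
  have "0 = (\<Sum>m<p. \<Sum>l<p. \<zeta> ^ (m * l) * \<omega> ^ l)"
    using v0 by simp
  also have "\<dots> = (\<Sum>l<p. (\<Sum>m<p. \<zeta> ^ (m * l)) * \<omega> ^ l)"
    unfolding sum_distrib_right by (rule sum.swap)
  also have "\<dots> = (\<Sum>l<p. if l = 0 then of_nat p else 0)"
    by (intro sum.cong) (auto simp: gs)
  also have "\<dots> = of_nat p"
    using \<open>prime p\<close> by (simp add: prime_gt_0_nat)
  finally show False using char by simp
qed

lemma power_conj:
  fixes u a :: "'d::division_ring"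
  assumes "u \<noteq> 0"
  shows "(u * a * inverse u) ^ n = u * a ^ n * inverse u"
proof (induction n)
  case (Suc n)
  have "(u * a * inverse u) ^ Suc n = u * a * (inverse u * u) * a ^ n * inverse u"
    unfolding power_Suc Suc by (simp only: mult.assoc)
  then show ?case using assms by (simp add: mult.assoc)
qed (use assms in simp)

section \<open>Cyclic division algebras of prime degree\<close>

lemma (in field_algebra) commutes_with_generated:
  assumes "generated_subalgebra S = UNIV" and "\<And>y. y \<in> S \<Longrightarrow> x * y = y * x"
  shows "x * y = y * x"
proof -
  have "x * (y * z) = (y * z) * x" if "x * y = y * x" "x * z = z * x" for y z
    using that by (metis mult.assoc)
  then have "subalgebra {y. x * y = y * x}"
    unfolding subalgebra_def subspace_def
    by (auto simp: distrib_left distrib_right scale_mult_left scale_mult_right)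
  then have "generated_subalgebra S \<subseteq> {y. x * y = y * x}"
    unfolding generated_subalgebra_def using assms(2) by (intro hull_minimal) auto
  then show ?thesis using assms(1) by auto
qed

text \<open>
  The Galois generator is conjugation by \<open>j\<close>, so \<open>conj_K\<close> says that it maps \<open>K\<close> into itself, and
  \<open>noncommuting\<close> that it moves \<open>i\<close>.
\<close>

locale cyclic_division_algebra = field_algebra scale
  for scale :: "'f::field \<Rightarrow> 'd::division_ring \<Rightarrow> 'd" (infixr \<open>*s\<close> 75) +
  fixes p :: nat and i j :: 'd and \<beta> :: 'f
  assumes p_prime: "prime p"
    and generates: "generated_subalgebra {i, j} = UNIV"
    and field_K: "extension_field (generated_subalgebra {i})"
    and conj_K: "t \<in> generated_subalgebra {i} \<Longrightarrow> j * t * inverse j \<in> generated_subalgebra {i}"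
    and beta_nonzero: "\<beta> \<noteq> 0" and j_power: "j ^ p = \<beta> *s 1"
    and central: central
    and noncommuting: "j * i \<noteq> i * j"
begin

abbreviation K :: "'d set" where "K \<equiv> generated_subalgebra {i}"

text \<open>On \<open>K\<close> this is the \<open>k\<close>-th power of the chosen generator of the Galois group.\<close>

abbreviation \<sigma> :: "nat \<Rightarrow> 'd \<Rightarrow> 'd" where "\<sigma> k a \<equiv> j ^ k * a * inverse (j ^ k)"

lemma scalar_commutes: "(a *s 1) * x = x * (a *s 1)"
  by (simp add: scale_mult_left scale_mult_right)

lemma scalar_power: "(a *s (1::'d)) ^ n = a ^ n *s 1"
  by (induction n) (simp_all add: scale_mult_left)

lemma p_pos: "p > 0" using p_prime by (simp add: prime_gt_0_nat)

lemma j_nonzero: "j \<noteq> 0"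
  using noncommuting by auto

lemma K_comm: "a \<in> K \<Longrightarrow> b \<in> K \<Longrightarrow> a * b = b * a"
  using field_K by (auto simp: extension_field_def)

lemma K_subalgebra: "subalgebra K"
  using field_K by (auto simp: extension_field_def)

lemma K_inverse: "a \<in> K \<Longrightarrow> inverse a \<in> K"
  using field_K K_subalgebra unfolding extension_field_def subalgebra_def
  by (metis inverse_unique inverse_zero)

lemma i_in_K: "i \<in> K"
  by (simp add: generated_subalgebra_def hull_inc)

lemma K_mult: "a \<in> K \<Longrightarrow> b \<in> K \<Longrightarrow> a * b \<in> K"
  using K_subalgebra by (auto simp: subalgebra_def)

lemma K_one: "1 \<in> K"
  using K_subalgebra by (auto simp: subalgebra_def)

lemma K_subspace: "subspace K"
  using K_subalgebra by (auto simp: subalgebra_def)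

lemma sigma_Suc: "\<sigma> (Suc k) a = j * \<sigma> k a * inverse j"
  using j_nonzero unfolding power_Suc
  by (subst nonzero_inverse_mult_distrib) (simp_all add: mult.assoc)

lemma sigma_in_K: "a \<in> K \<Longrightarrow> \<sigma> k a \<in> K"
proof (induction k)
  case (Suc k)
  then show ?case using conj_K by (simp only: sigma_Suc)
qed simp

lemma j_power_mult: "j ^ k * a = \<sigma> k a * j ^ k"
  using j_nonzero by (simp add: mult.assoc)

lemma central_imp_scalar: "(\<And>x. z * x = x * z) \<Longrightarrow> \<exists>a. z = a *s 1"
  using central unfolding central_def scalars_def by blast

text \<open>
  If two conjugates agreed, a power \<open>j ^ m\<close> with \<open>0 < m < p\<close> would commute with \<open>i\<close>.  So does the
  scalar \<open>j ^ p\<close>, and as \<open>m\<close> is prime to \<open>p\<close>, \<open>j\<close> itself would commute with \<open>i\<close>.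
\<close>

lemma conjugates_distinct: "inj_on (\<lambda>k. \<sigma> k i) {..<p}"
proof -
  have "False" if kl: "k < l" "l < p" and eq: "\<sigma> k i = \<sigma> l i" for k l
  proof -
    define m where "m = l - k"
    have l: "l = k + m" and m: "0 < m" "m < p" using kl by (auto simp: m_def)
    have "j ^ k * i * j ^ m = \<sigma> k i * j ^ l"
      using j_nonzero by (simp add: l power_add mult.assoc) (simp flip: mult.assoc)
    also have "\<dots> = j ^ k * (j ^ m * i)"
      using j_power_mult[of l i] by (simp add: eq) (simp add: l power_add mult.assoc)
    finally have m_comm: "j ^ m * i = i * j ^ m"
      using j_nonzero by (simp add: mult.assoc)
    have "coprime m p"
      using m p_prime by (metis coprime_commute nat_dvd_not_less prime_imp_coprime)
    then obtain x y where xy: "m * x = p * y + 1"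
      using coprime_bezout_strong[of m p] p_prime prime_gt_1_nat by force
    have jp: "j ^ (p * y) * d = d * j ^ (p * y)" for d
      unfolding power_mult j_power scalar_power by (rule scalar_commutes)
    have "j ^ (m * x) * i = i * j ^ (m * x)"
      unfolding power_mult by (rule power_commuting_commutes) (rule m_comm)
    then have "j ^ (p * y) * (j * i) = j ^ (p * y) * (i * j)"
      unfolding xy power_add by (simp add: mult.assoc) (metis jp mult.assoc)
    then show False using j_nonzero noncommuting by simp
  qed
  then show ?thesis unfolding inj_on_def by (metis lessThan_iff linorder_neqE_nat)
qed

text \<open>
  The sums of this shape form a subspace stable under left multiplication by \<open>i\<close> and by \<open>j\<close>, the
  latter because \<open>j ^ p\<close> is a scalar; so they form a left ideal, and it contains \<open>1\<close>.
\<close>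

lemma K_expansion: "\<exists>t. (\<forall>k. t k \<in> K) \<and> d = (\<Sum>k<p. t k * j ^ k)"
proof -
  define A where "A = {\<Sum>k<p. t k * j ^ k | t. \<forall>k. t k \<in> K}"
  have AI: "(\<Sum>k<p. t k * j ^ k) \<in> A" if "\<And>k. t k \<in> K" for t
    using that by (auto simp: A_def)
  have A_zero: "0 \<in> A"
    using AI[of "\<lambda>_. 0"] K_subspace by (simp add: subspace_0)
  have A_add: "x + y \<in> A" if "x \<in> A" "y \<in> A" for x y
  proof -
    from that obtain t u where "\<And>k. t k \<in> K" "\<And>k. u k \<in> K"
      "x = (\<Sum>k<p. t k * j ^ k)" "y = (\<Sum>k<p. u k * j ^ k)" by (auto simp: A_def)
    then show ?thesis
      using AI[of "\<lambda>k. t k + u k"] K_subspace by (simp add: subspace_add sum.distrib distrib_right)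
  qed
  have A_K: "a * x \<in> A" if "a \<in> K" "x \<in> A" for a x
  proof -
    from that obtain t where "\<And>k. t k \<in> K" "x = (\<Sum>k<p. t k * j ^ k)" by (auto simp: A_def)
    then show ?thesis
      using AI[of "\<lambda>k. a * t k"] that by (simp add: K_mult sum_distrib_left mult.assoc)
  qed
  have A_scale: "c *s x \<in> A" if "x \<in> A" for c x
    using A_K[of "c *s 1" x] that K_one K_subspace by (simp add: subspace_scale scale_mult_left)
  have A_j: "j * x \<in> A" if "x \<in> A" for x
  proof -
    from that obtain t where t: "\<And>k. t k \<in> K" "x = (\<Sum>k<p. t k * j ^ k)" by (auto simp: A_def)
    obtain q where q: "p = Suc q" using p_pos gr0_implies_Suc by blast
    \<comment> \<open>The coefficients of \<open>j * x\<close>: shifted by one place, the last one wrapping around with \<open>\<beta>\<close>.\<close>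
    define u where "u k = (case k of 0 \<Rightarrow> \<beta> *s \<sigma> 1 (t q) | Suc k' \<Rightarrow> \<sigma> 1 (t k'))" for k
    have uK: "u k \<in> K" for k
      using t(1) sigma_in_K[of _ 1] K_subspace by (auto simp: u_def subspace_scale split: nat.split)
    have step: "j * (t k * j ^ k) = \<sigma> 1 (t k) * j ^ Suc k" for k
      using arg_cong[OF j_power_mult[of 1 "t k"], of "\<lambda>x. x * j ^ k"]
      by (simp only: power_Suc power_one_right mult.assoc)
    have "j * x = (\<Sum>k<Suc q. \<sigma> 1 (t k) * j ^ Suc k)"
      unfolding t(2) sum_distrib_left step q ..
    also have "\<dots> = (\<Sum>k<q. \<sigma> 1 (t k) * j ^ Suc k) + \<sigma> 1 (t q) * (\<beta> *s 1)"
      using j_power unfolding q by (simp only: sum.lessThan_Suc)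
    also have "\<dots> = (\<Sum>k<q. u (Suc k) * j ^ Suc k) + u 0 * j ^ 0"
      by (simp add: u_def scale_mult_right)
    also have "\<dots> = (\<Sum>k<p. u k * j ^ k)"
      by (simp add: q sum.lessThan_Suc_shift del: sum.lessThan_Suc)
    finally show ?thesis using AI uK by simp
  qed
  have "subalgebra {x. \<forall>a\<in>A. x * a \<in> A}"
    unfolding subalgebra_def subspace_def
    using A_zero A_add A_scale by (auto simp: distrib_right scale_mult_left mult.assoc)
  then have "generated_subalgebra {i, j} \<subseteq> {x. \<forall>a\<in>A. x * a \<in> A}"
    unfolding generated_subalgebra_def using A_K[OF i_in_K] A_j by (intro hull_minimal) auto
  moreover have "1 \<in> A"
    using AI[of "\<lambda>k. if k = 0 then 1 else 0"] K_one K_subspace p_pos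
    by (simp add: if_distrib[where f = "\<lambda>x. x * _"] subspace_0 cong: if_cong)
  ultimately have "d * 1 \<in> A" using generates by blast
  then show ?thesis by (auto simp: A_def)
qed

text \<open>
  If \<open>d = \<Sum>k<p. t k * j ^ k\<close> commutes with \<open>i\<close>, then \<open>t 0 - d\<close> and the \<open>t k * j ^ k\<close> with \<open>k > 0\<close> are
  eigenvectors of right multiplication by \<open>i\<close> for the distinct conjugates of \<open>i\<close>, and they add up
  to \<open>0\<close>.  Hence \<open>d = t 0\<close>.
\<close>

lemma centralizer_subset_K:
  assumes "d * i = i * d" shows "d \<in> K"
proof -
  obtain t where t: "\<And>k. t k \<in> K" "d = (\<Sum>k<p. t k * j ^ k)"
    using K_expansion[of d] by blast
  define e where "e k = (if k = 0 then t 0 - d else t k * j ^ k)" for k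
  have eig: "e k * i = \<sigma> k i * e k" for k
  proof (cases "k = 0")
    case True
    then show ?thesis
      using assms K_comm[OF t(1)[of 0] i_in_K] by (simp add: e_def algebra_simps)
  next
    case False
    have "t k * (j ^ k * i) = t k * \<sigma> k i * j ^ k"
      by (subst j_power_mult) (simp only: mult.assoc)
    also have "t k * \<sigma> k i = \<sigma> k i * t k"
      by (rule K_comm[OF t(1) sigma_in_K[OF i_in_K]])
    finally show ?thesis using False by (simp add: e_def mult.assoc)
  qed
  obtain q where q: "p = Suc q" using p_pos gr0_implies_Suc by blast
  have "(\<Sum>k<p. e k) = (\<Sum>k<p. t k * j ^ k) - d"
    unfolding q sum.lessThan_Suc_shift by (simp add: e_def)
  then have sum0: "(\<Sum>k<p. e k) = 0" using t(2) by simp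
  have "e 0 = 0"
    by (rule right_eigenvectors_independent[where S = "{..<p}" and c = "\<lambda>k. \<sigma> k i"])
      (use eig sum0 p_pos conjugates_distinct in \<open>auto intro: K_comm sigma_in_K i_in_K\<close>)
  then show ?thesis using t(1)[of 0] by (simp add: e_def)
qed

text \<open>
  Let \<open>t\<close> be such a root, \<open>z = t\<inverse> j\<close> and \<open>\<zeta> = z ^ p\<close>, which is \<open>\<beta>\<close> divided by the norm of \<open>t\<close>.
  It is central, and comparing the \<open>p\<close>-th power of the norm with the norm of \<open>t ^ p = \<beta>\<close> gives
  \<open>\<zeta> ^ p = 1\<close>.  It is not \<open>1\<close>, since otherwise \<open>1 + z + \<dots> = 0\<close>, although the powers of \<open>z\<close> are
  eigenvectors of right multiplication by \<open>i\<close> for distinct eigenvalues.  So \<open>\<zeta>\<close> generates the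
  \<open>p\<close>-th roots of unity in \<open>D\<close>; in particular \<open>\<omega> = \<sigma> 1 t / t\<close> is central.  Then
  \<open>j = t z\<close> gives \<open>\<beta> = j ^ p = \<omega> ^ (p (p - 1) / 2) * \<beta> * \<zeta>\<close>, where the power of \<open>\<omega>\<close> is \<open>1\<close> as
  \<open>p\<close> is odd.  Hence \<open>\<zeta> = 1\<close>, a contradiction.
\<close>

lemma no_pth_root_in_K:
  assumes "odd p" and tK: "t \<in> K" shows "t ^ p \<noteq> \<beta> *s 1"
proof
  assume tp: "t ^ p = \<beta> *s 1"
  have b0: "\<beta> *s (1::'d) \<noteq> 0" using beta_nonzero by simp
  have t0: "t \<noteq> 0" using tp b0 p_pos by (metis power_0_left not_gr_zero)
  define z where "z = inverse t * j"
  have tz: "t * z = j" using t0 by (simp add: z_def flip: mult.assoc)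
  have z1: "z * a = \<sigma> 1 a * z" if "a \<in> K" for a
  proof -
    have "z * a = inverse t * \<sigma> 1 a * j"
      using arg_cong[OF j_power_mult[of 1 a], of "\<lambda>x. inverse t * x"]
      by (simp only: z_def mult.assoc power_one_right)
    also have "inverse t * \<sigma> 1 a = \<sigma> 1 a * inverse t"
      by (rule K_comm[OF K_inverse[OF tK] sigma_in_K[OF that]])
    finally show ?thesis by (simp add: z_def mult.assoc)
  qed
  have zn: "z ^ k * a = \<sigma> k a * z ^ k" if "a \<in> K" for k a
  proof (induction k)
    case (Suc k)
    have "z ^ Suc k * a = z * \<sigma> k a * z ^ k" by (simp add: Suc mult.assoc)
    also have "\<dots> = \<sigma> 1 (\<sigma> k a) * z ^ Suc k"
      unfolding z1[OF sigma_in_K[OF that]] power_Suc by (simp only: mult.assoc)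
    also have "\<sigma> 1 (\<sigma> k a) = \<sigma> (Suc k) a"
      by (simp only: sigma_Suc power_one_right)
    finally show ?case .
  qed simp
  define \<zeta> where "\<zeta> = z ^ p"
  have sigma_p: "\<sigma> p a = a" for a
    using b0 scalar_commutes[of \<beta> a] by (simp add: j_power mult.assoc)
  have zetaK: "\<zeta> * a = a * \<zeta>" if "a \<in> K" for a
    using zn[OF that, of p] by (simp only: sigma_p \<zeta>_def)
  have "\<zeta> * z = z * \<zeta>" by (simp add: \<zeta>_def power_commutes)
  then have "\<zeta> * j = j * \<zeta>"
    using zetaK[OF tK] by (metis tz mult.assoc)
  then have zeta_central: "\<zeta> * d = d * \<zeta>" for d
    using commutes_with_generated[OF generates] zetaK[OF i_in_K] by blast
  have zeta_power_central: "\<zeta> ^ k * d = d * \<zeta> ^ k" for k d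
    using zeta_central by (metis power_commuting_commutes)
  have zeta_ne_1: "\<zeta> \<noteq> 1"
  proof
    assume "\<zeta> = 1"
    have "z \<noteq> 1"
      using tz K_comm[OF tK i_in_K] noncommuting by auto
    then have "(\<Sum>k<p. z ^ k) = 0"
      using geometric_sum_eq_0[of z p] \<open>\<zeta> = 1\<close> by (simp add: \<zeta>_def)
    then have "z ^ 0 = 0"
      by (intro right_eigenvectors_independent[where S = "{..<p}" and c = "\<lambda>k. \<sigma> k i" and x = i and e = "\<lambda>k. z ^ k"])
        (use p_pos conjugates_distinct zn[OF i_in_K] in \<open>auto intro: K_comm sigma_in_K i_in_K\<close>)
    then show False by simp
  qed
  \<comment> \<open>\<open>P p\<close> is the norm of \<open>t\<close>.\<close>
  define P where "P n = (\<Prod>k\<leftarrow>[0..<n]. \<sigma> k t)" for n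
  have P_K: "P n \<in> K" for n
    by (induction n) (auto simp: P_def K_one intro: K_mult sigma_in_K tK)
  have jP: "j ^ n = P n * z ^ n" for n
  proof (induction n)
    case (Suc n)
    have "j ^ Suc n = P n * (z ^ n * t) * z" by (simp only: power_Suc2 Suc tz mult.assoc)
    also have "\<dots> = P (Suc n) * z ^ Suc n"
      by (simp only: zn[OF tK]) (simp add: P_def mult.assoc power_commutes)
    finally show ?case .
  qed (simp add: P_def)
  have sigma_power: "\<sigma> k t ^ p = \<beta> *s 1" for k
    using j_nonzero by (simp add: power_conj tp) (simp add: scale_mult_left scale_mult_right)
  have P_power: "P n ^ p = (\<beta> *s 1) ^ n" for n
  proof (induction n)
    case (Suc n)
    have "P n * \<sigma> n t = \<sigma> n t * P n" by (intro K_comm P_K sigma_in_K tK)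
    then have "P (Suc n) ^ p = P n ^ p * \<sigma> n t ^ p"
      using power_mult_power_commuting_up_to_central[of "\<sigma> n t" "P n" 1 p]
      by (simp add: P_def)
    then show ?case using Suc sigma_power by (simp add: power_commutes)
  qed (simp add: P_def)
  have beta_central: "(\<beta> *s 1) ^ n * d = d * (\<beta> *s 1) ^ n" for n d
    unfolding scalar_power by (rule scalar_commutes)
  have "(\<beta> *s 1) ^ p = (P p * \<zeta>) ^ p"
    using jP[of p] by (simp add: j_power \<zeta>_def)
  also have "\<dots> = (\<beta> *s 1) ^ p * \<zeta> ^ p"
    using power_mult_power_commuting_up_to_central[of \<zeta> "P p" 1 p] zeta_central
    by (simp add: P_power)
  finally have zeta_p: "\<zeta> ^ p = 1" using b0 by simp
  define \<omega> where "\<omega> = \<sigma> 1 t * inverse t"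
  have "\<omega> ^ p = \<sigma> 1 t ^ p * inverse t ^ p"
    using power_mult_power_commuting_up_to_central[of "inverse t" "\<sigma> 1 t" 1 p]
      K_comm[OF K_inverse[OF tK] sigma_in_K[OF tK, of 1]] by (simp add: \<omega>_def)
  then have omega_p: "\<omega> ^ p = 1"
    using b0 unfolding sigma_power power_inverse tp by simp
  have zt: "z * t = \<omega> * t * z"
    using z1[OF tK] t0 by (simp add: \<omega>_def mult.assoc)
  \<comment> \<open>In characteristic \<open>p\<close> a scalar \<open>a\<close> with \<open>a ^ p = 1\<close> has \<open>(a - 1) ^ p = 0\<close>.\<close>
  have char: "of_nat p \<noteq> (0::'d)"
  proof
    assume p0: "of_nat p = (0::'d)"
    obtain a where a: "\<zeta> = a *s 1" using central_imp_scalar zeta_central by blast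
    have inj: "c = c'" if "c *s (1::'d) = c' *s 1" for c c'
      using that by simp
    have "of_nat p *s (1::'d) = 0"
    proof -
      have "of_nat n *s (1::'d) = of_nat n" for n
        by (induction n) (simp_all add: scale_left_distrib)
      then show ?thesis using p0 by simp
    qed
    then have "CHAR('f) dvd p" by (simp add: of_nat_eq_0_iff_char_dvd)
    then have char_f: "CHAR('f) = p"
      using p_prime CHAR_not_1[where 'a = 'f] by (auto simp: prime_nat_iff)
    have ap: "a ^ p = 1"
      using zeta_p inj[of "a ^ p" 1] by (simp add: a scalar_power)
    have "(a - 1 + 1) ^ p = (a - 1) ^ p + 1 ^ p"
      by (rule freshmans_dream) (use char_f p_prime in auto)
    then have "a = 1" using ap p_pos by simp
    then show False using zeta_ne_1 a by simp
  qed
  obtain m where "\<zeta> ^ m * \<omega> = 1"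
    using prime_root_of_unity_generates[OF p_prime char zeta_central zeta_p zeta_ne_1 omega_p] by blast
  then have "\<omega> = inverse (\<zeta> ^ m)" by (metis inverse_unique)
  moreover have "inverse (\<zeta> ^ m) * d = d * inverse (\<zeta> ^ m)" for d
    using zeta_power_central by (rule mult_commute_imp_mult_inverse_commute)
  ultimately have omega_central: "\<omega> * d = d * \<omega>" for d by simp
  have "p * (p - 1) div 2 = p * ((p - 1) div 2)"
    using \<open>odd p\<close> by (simp add: div_mult_swap)
  then have "\<omega> ^ (p * (p - 1) div 2) = 1"
    by (simp only: power_mult omega_p power_one)
  then have "\<beta> *s 1 = \<beta> *s 1 * \<zeta>"
    using power_mult_power_commuting_up_to_central[OF zt omega_central, of p]
    by (simp add: tz j_power tp \<zeta>_def)
  then show False using b0 zeta_ne_1 by simp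
qed

end

section \<open>Left ideals of polynomial rings\<close>

lemma exists_maximal_left_ideal:
  fixes R :: "'a::ring_1 set"
  assumes J: "left_ideal R J" "1 \<notin> J" and "1 \<in> R"
  shows "\<exists>I. maximal_left_ideal R I \<and> J \<subseteq> I"
proof -
  define \<A> where "\<A> = {I. left_ideal R I \<and> 1 \<notin> I \<and> J \<subseteq> I}"
  have "\<exists>M\<in>\<A>. \<forall>X\<in>\<A>. M \<subseteq> X \<longrightarrow> X = M"
  proof (rule subset_Zorn_nonempty)
    show "\<A> \<noteq> {}" using J by (auto simp: \<A>_def)
    fix \<C> assume ne: "\<C> \<noteq> {}" and chain: "subset.chain \<A> \<C>"
    then have mem: "left_ideal R I" "1 \<notin> I" "J \<subseteq> I" if "I \<in> \<C>" for I
      using that by (auto simp: \<A>_def subset_chain_def)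
    have "x + y \<in> \<Union>\<C>" if xy: "x \<in> \<Union>\<C>" "y \<in> \<Union>\<C>" for x y
    proof -
      obtain X Y where XY: "x \<in> X" "X \<in> \<C>" "y \<in> Y" "Y \<in> \<C>" using xy by blast
      then have "X \<subseteq> Y \<or> Y \<subseteq> X" using chain by (auto simp: subset_chain_def)
      then show ?thesis
        using XY mem(1)[of X] mem(1)[of Y] unfolding left_ideal_def by blast
    qed
    then have "left_ideal R (\<Union>\<C>)"
      using ne mem(1) unfolding left_ideal_def by blast
    moreover have "1 \<notin> \<Union>\<C>" "J \<subseteq> \<Union>\<C>"
      using ne mem(2,3) by blast+
    ultimately show "\<Union>\<C> \<in> \<A>"
      by (simp add: \<A>_def)
  qed
  then obtain M where "M \<in> \<A>" and M_max: "\<And>X. X \<in> \<A> \<Longrightarrow> M \<subseteq> X \<Longrightarrow> X = M"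
    by blast
  then have M: "left_ideal R M" "1 \<notin> M" "J \<subseteq> M"
    by (auto simp: \<A>_def)
  have max: "X = M" if "left_ideal R X" "1 \<notin> X" "M \<subseteq> X" for X
    using that M(3) by (intro M_max) (auto simp: \<A>_def)
  have "X = M \<or> X = R" if X: "left_ideal R X" "M \<subseteq> X" for X
  proof (cases "1 \<in> X")
    case True
    then have "R \<subseteq> X" using X(1) unfolding left_ideal_def by force
    then show ?thesis using X(1) unfolding left_ideal_def by blast
  qed (use X max in blast)
  then show ?thesis
    using M \<open>1 \<in> R\<close> unfolding maximal_left_ideal_def by blast
qed

abbreviation const :: "'d::ring_1 \<Rightarrow> ((nat \<Rightarrow>\<^sub>0 nat) \<Rightarrow>\<^sub>0 'd)" where
  "const d \<equiv> Poly_Mapping.single 0 d"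

definition var :: "nat \<Rightarrow> ((nat \<Rightarrow>\<^sub>0 nat) \<Rightarrow>\<^sub>0 'd::ring_1)" where
  "var k = Poly_Mapping.single (Poly_Mapping.single k 1) 1"

lemma const_mult: "const a * const b = const (a * b)" "const a * (const b * f) = const (a * b) * f"
  by (simp_all add: mult_single flip: mult.assoc)

lemma const_add: "const (a + b) = const a + const b"
  by (simp add: single_add)

lemma const_diff: "const (a - b) = const a - const b"
  by (simp add: single_diff)

lemma var_const: "var k * const d = const d * var k" "var k * (const d * f) = const d * (var k * f)"
  by (simp_all add: var_def mult_single flip: mult.assoc)

lemma var_var: "(var k :: (nat \<Rightarrow>\<^sub>0 nat) \<Rightarrow>\<^sub>0 'd::ring_1) * var l = var l * var k"
  by (simp add: var_def mult_single add.commute)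

lemma const_in_polys: "const d \<in> polys n"
  by (simp add: polys_def)

lemma var_in_polys: "1 \<le> k \<Longrightarrow> k \<le> n \<Longrightarrow> var k \<in> polys n"
  by (simp add: polys_def var_def)

lemma diff_in_polys: "P \<in> polys n \<Longrightarrow> Q \<in> polys n \<Longrightarrow> P - Q \<in> polys n"
  using add_in_polys[OF _ uminus_in_polys] by force

lemma power_in_polys: "P \<in> polys n \<Longrightarrow> P ^ k \<in> polys n"
  by (induction k) (simp_all add: one_in_polys mult_in_polys)

lemmas in_polys = const_in_polys var_in_polys diff_in_polys add_in_polys mult_in_polys one_in_polys
  power_in_polys

lemma polys_induct [consumes 1, case_names zero add]:
  assumes "f \<in> polys n" and "P 0"
    and "\<And>m d f. Poly_Mapping.keys m \<subseteq> {1..n} \<Longrightarrow> f \<in> polys n \<Longrightarrow> P f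
      \<Longrightarrow> P (Poly_Mapping.single m d + f)"
  shows "P f"
  using assms(1)
proof (induction f rule: update_induct)
  case (update f a b)
  have eq: "Poly_Mapping.update a b f = Poly_Mapping.single a b + f"
    using update.hyps(1)
    by (intro poly_mapping_eqI) (auto simp: lookup_update lookup_add lookup_single in_keys_iff when_def)
  have "Poly_Mapping.keys (Poly_Mapping.update a b f) = insert a (Poly_Mapping.keys f)"
    using update.hyps(2) by (auto simp: keys_update)
  then have "Poly_Mapping.keys a \<subseteq> {1..n}" "f \<in> polys n"
    using update.prems by (auto simp: polys_def)
  then show ?case
    unfolding eq using assms(3) update.IH by blast
qed (use assms(2) in simp)

lemma left_ideal_diff:
  assumes "left_ideal (polys n) I" "P \<in> I" "Q \<in> I"
  shows "P - Q \<in> I"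
proof -
  have "- 1 * Q \<in> I"
    using assms uminus_in_polys[OF one_in_polys] unfolding left_ideal_def by blast
  then have "P + - 1 * Q \<in> I"
    using assms unfolding left_ideal_def by blast
  then show ?thesis by simp
qed

text \<open>
  Division on the right by \<open>x - a\<close>, multiplication by \<open>x\<close> on the left raising the degree of a
  monomial by one.
\<close>

lemma polys_division:
  assumes "h \<in> polys 1"
  shows "\<exists>q\<in>polys 1. \<exists>c. h = q * (var 1 - const a) + const c"
  using assms
proof (induction h rule: polys_induct)
  case zero
  have "0 = 0 * (var 1 - const a) + const 0" by simp
  then show ?case by (metis const_in_polys single_zero)
next
  case (add m d f)
  have m: "m = Poly_Mapping.single 1 (Poly_Mapping.lookup m 1)"
    using add.hyps(1)
    by (intro poly_mapping_eqI) (auto simp: lookup_single when_def in_keys_iff subset_iff)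
  have "\<exists>q\<in>polys 1. \<exists>c. Poly_Mapping.single (Poly_Mapping.single 1 k) d
      = q * (var 1 - const a) + const c" for k
  proof (induction k)
    case 0
    have "const d = 0 * (var 1 - const a) + const d" by simp
    then show ?case by (metis const_in_polys single_zero)
  next
    case (Suc k)
    then obtain q c where q: "q \<in> polys 1"
      "Poly_Mapping.single (Poly_Mapping.single 1 k) d = q * (var 1 - const a) + const c" by blast
    have "Poly_Mapping.single (Poly_Mapping.single 1 (Suc k)) d
        = var 1 * Poly_Mapping.single (Poly_Mapping.single 1 k) d"
      by (simp add: var_def mult_single flip: single_add)
    also have "\<dots> = (var 1 * q + const c) * (var 1 - const a) + const (c * a)"
      unfolding q(2) by (simp add: algebra_simps var_const const_mult)
    finally have "Poly_Mapping.single (Poly_Mapping.single 1 (Suc k)) d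
        = (var 1 * q + const c) * (var 1 - const a) + const (c * a)" .
    moreover have "var 1 * q + const c \<in> polys 1"
      by (intro in_polys q(1)) simp_all
    ultimately show ?case by blast
  qed
  then obtain q c where "q \<in> polys 1" "Poly_Mapping.single m d = q * (var 1 - const a) + const c"
    using m by metis
  moreover obtain q' c' where "q' \<in> polys 1" "f = q' * (var 1 - const a) + const c'"
    using add.IH by blast
  moreover have "(q * (var 1 - const a) + const c) + (q' * (var 1 - const a) + const c')
      = (q + q') * (var 1 - const a) + const (c + c')"
    by (simp add: distrib_right const_add)
  ultimately show ?case using add_in_polys by metis
qed

text \<open>
  Modulo \<open>(x - i) (x - i')\<close>, every left multiple of \<open>x - i'\<close> is a constant multiple of it, by
  division by \<open>x - i\<close>.  So unless \<open>x - i'\<close> lies in \<open>N\<close>, maximality writes \<open>1\<close> as an element of \<open>N\<close>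
  plus \<open>c (x - i')\<close>, which exhibits \<open>x - i' - c\<inverse>\<close> in \<open>N\<close>.
\<close>

lemma maximal_left_ideal_contains_linear:
  fixes i i' :: "'d::division_ring"
  assumes N: "maximal_left_ideal (polys 1) N"
    and g: "(var 1 - const i) * (var 1 - const i') \<in> N"
  shows "\<exists>a. var 1 - const a \<in> N"
proof (rule ccontr)
  assume none: "\<not> ?thesis"
  let ?l = "var 1 - const i'"
  have l_polys: "?l \<in> polys 1" by (intro in_polys) auto
  have NI: "left_ideal (polys 1) N" and "N \<noteq> polys 1"
    and max: "\<And>X. left_ideal (polys 1) X \<Longrightarrow> N \<subseteq> X \<Longrightarrow> X = N \<or> X = polys 1"
    using N by (auto simp: maximal_left_ideal_def)
  have N_add: "P + Q \<in> N" if "P \<in> N" "Q \<in> N" for P Q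
    using NI that by (auto simp: left_ideal_def)
  have N_mult: "P * Q \<in> N" if "P \<in> polys 1" "Q \<in> N" for P Q
    using NI that by (auto simp: left_ideal_def)
  have "1 \<notin> N"
    using \<open>N \<noteq> polys 1\<close> N_mult[of _ 1] NI by (auto simp: left_ideal_def)
  define X where "X = {P + Q * ?l | P Q. P \<in> N \<and> Q \<in> polys 1}"
  have N_polys: "N \<subseteq> polys 1" and N0: "0 \<in> N" using NI by (auto simp: left_ideal_def)
  have z: "(0 :: (nat \<Rightarrow>\<^sub>0 nat) \<Rightarrow>\<^sub>0 'd) \<in> polys 1" by (simp add: polys_def)
  have NX: "N \<subseteq> X" unfolding X_def using z by force
  have "left_ideal (polys 1) X"
    unfolding left_ideal_def
  proof (intro conjI ballI)
    show "X \<subseteq> polys 1" using N_polys l_polys by (auto simp: X_def intro: in_polys)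
    show "0 \<in> X" using N0 NX by blast
  next
    fix x y assume "x \<in> X" "y \<in> X"
    then obtain P Q P' Q' where xy: "x = P + Q * ?l" "y = P' + Q' * ?l"
      and "P \<in> N" "P' \<in> N" "Q \<in> polys 1" "Q' \<in> polys 1" by (auto simp: X_def)
    moreover have "x + y = (P + P') + (Q + Q') * ?l"
      unfolding xy by (simp add: algebra_simps)
    ultimately show "x + y \<in> X" unfolding X_def using N_add add_in_polys by blast
  next
    fix r x :: "(nat \<Rightarrow>\<^sub>0 nat) \<Rightarrow>\<^sub>0 'd" assume "r \<in> polys 1" "x \<in> X"
    then obtain P Q where x: "x = P + Q * ?l" and "P \<in> N" "Q \<in> polys 1" by (auto simp: X_def)
    moreover have "r * x = r * P + (r * Q) * ?l" unfolding x by (simp add: algebra_simps)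
    ultimately show "r * x \<in> X" unfolding X_def using \<open>r \<in> polys 1\<close> N_mult mult_in_polys by blast
  qed
  moreover have "0 + 1 * ?l \<in> X" unfolding X_def using N0 one_in_polys by blast
  ultimately have "X = polys 1" using max[OF _ NX] none by auto
  then obtain P Q where PQ: "1 = P + Q * ?l" "P \<in> N" "Q \<in> polys 1"
    using one_in_polys[of 1] unfolding X_def by blast
  obtain q c where q: "q \<in> polys 1" "Q = q * (var 1 - const i) + const c"
    using polys_division[OF PQ(3)] by blast
  have "P + q * ((var 1 - const i) * ?l) \<in> N" by (rule N_add[OF PQ(2) N_mult[OF q(1) g]])
  also have "P + q * ((var 1 - const i) * ?l) = 1 - const c * ?l"
    using PQ(1) unfolding q(2) by (simp add: algebra_simps)
  finally have m: "1 - const c * ?l \<in> N" .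
  then have "c \<noteq> 0" using \<open>1 \<notin> N\<close> by auto
  have "const (- inverse c) * (1 - const c * ?l) \<in> N" by (intro N_mult m in_polys)
  also have "const (- inverse c) * (1 - const c * ?l) = var 1 - const (i' + inverse c)"
    using \<open>c \<noteq> 0\<close> by (simp add: right_diff_distrib const_mult const_add single_uminus flip: mult.assoc)
  finally show False using none by blast
qed

section \<open>Left ideals defined by inverse systems\<close>

text \<open>
  A linear form on \<open>D[x, y]\<close>: the coefficient of \<open>x\<^sup>k y\<^sup>l\<close> is paired with \<open>u (s + l) * i ^ k\<close>.  The
  offset \<open>s\<close> makes the family of these forms stable under the ring: multiplying a polynomial by
  \<open>x\<close> multiplies the value by \<open>i\<close> on the right, and multiplying it by \<open>y\<close> shifts \<open>s\<close>.
\<close>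

definition pairing ::
  "(nat \<Rightarrow> 'd) \<Rightarrow> 'd \<Rightarrow> nat \<Rightarrow> ((nat \<Rightarrow>\<^sub>0 nat) \<Rightarrow>\<^sub>0 'd::ring_1) \<Rightarrow> 'd" where
  "pairing u i s f = (\<Sum>m\<in>Poly_Mapping.keys f.
     Poly_Mapping.lookup f m * (u (s + Poly_Mapping.lookup m 2) * i ^ Poly_Mapping.lookup m 1))"

lemma pairing_zero: "pairing u i s 0 = 0"
  by (simp add: pairing_def)

lemma pairing_add: "pairing u i s (f + g) = pairing u i s f + pairing u i s g"
  unfolding pairing_def
  by (rule setsum_keys_plus_distrib) (simp_all add: distrib_right)

lemma pairing_diff: "pairing u i s (f - g) = pairing u i s f - pairing u i s g"
  using pairing_add[of u i s "f - g" g] by (simp add: algebra_simps)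

lemma pairing_single: "pairing u i s (Poly_Mapping.single m d)
    = d * (u (s + Poly_Mapping.lookup m 2) * i ^ Poly_Mapping.lookup m 1)"
  by (simp add: pairing_def)

lemma pairing_monomial_mult:
  assumes "f \<in> polys n"
  shows "pairing u i s (Poly_Mapping.single m d * f)
    = d * pairing u i (s + Poly_Mapping.lookup m 2) f * i ^ Poly_Mapping.lookup m 1"
  using assms
proof (induction f rule: polys_induct)
  case (add m' d' f)
  then show ?case
    by (simp add: distrib_left distrib_right pairing_add pairing_single mult_single lookup_add
        power_add mult.assoc add.assoc)
      (simp add: add.left_commute add.commute flip: power_add)
qed (simp add: pairing_zero)

lemma pairing_const_mult: "f \<in> polys n \<Longrightarrow> pairing u i s (const d * f) = d * pairing u i s f"
  by (simp add: pairing_monomial_mult)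

lemma pairing_var1_mult: "f \<in> polys n \<Longrightarrow> pairing u i s (var 1 * f) = pairing u i s f * i"
  by (simp add: var_def pairing_monomial_mult lookup_single)

lemma pairing_var2_mult: "f \<in> polys n \<Longrightarrow> pairing u i s (var 2 * f) = pairing u i (s + 1) f"
  by (simp add: var_def pairing_monomial_mult lookup_single)

lemma pairing_const: "pairing u i s (const d) = d * u s"
  by (simp add: pairing_single)

lemma pairing_one: "pairing u i s 1 = u s"
  using pairing_const[of u i s 1] by simp

lemma pairing_var2_power: "pairing u i s (var 2 ^ k) = u (s + k)"
  by (induction k arbitrary: s)
    (simp_all add: pairing_one pairing_var2_mult[of _ 2] in_polys)

text \<open>
  The annihilator of the sequence \<open>u\<close>, when \<open>x\<close> acts on sequences by right multiplication by \<open>i\<close> and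
  \<open>y\<close> by the shift: a noncommutative form of Macaulay's inverse systems.
\<close>

definition inverse_system_ideal :: "(nat \<Rightarrow> 'd) \<Rightarrow> 'd \<Rightarrow> ((nat \<Rightarrow>\<^sub>0 nat) \<Rightarrow>\<^sub>0 'd::ring_1) set" where
  "inverse_system_ideal u i = {f \<in> polys 2. \<forall>s. pairing u i s f = 0}"

lemma left_ideal_inverse_system: "left_ideal (polys 2) (inverse_system_ideal u i)"
proof -
  have "pairing u i s (r * f) = 0"
    if r: "r \<in> polys 2" and f: "f \<in> polys 2" "\<And>s. pairing u i s f = 0" for r f s
    using r
    by (induction r rule: polys_induct)
      (simp_all add: pairing_zero distrib_right pairing_add pairing_monomial_mult[OF f(1)] f(2))
  then show ?thesis
    unfolding left_ideal_def inverse_system_ideal_def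
    by (auto simp: pairing_zero pairing_add intro: in_polys) (simp add: polys_def)
qed

section \<open>A criterion for not being Amitsur-Small\<close>

text \<open>
  The sequence \<open>u\<close> encodes the vector \<open>v = 1 + j b\<close> of the module of polynomials in an indeterminate
  \<open>b\<close> subject to \<open>b\<^sup>n = \<beta>\<close>: its entry \<open>u s\<close> is the constant coefficient of \<open>b\<^sup>s v\<close>,
  the one of \<open>b\<^sup>s\<close> itself being \<open>A s\<close>.  The annihilator \<open>J\<close> of \<open>u\<close>
  is proper, and the three elements of \<open>J\<close> displayed in the proof determine a maximal left ideal
  containing it well enough to extract the forbidden root of \<open>\<beta>\<close>.
\<close>

proposition not_amitsur_smallI:
  fixes i i' j \<beta> :: "'d::division_ring"
  assumes "2 \<le> n" and beta_central: "\<And>d. \<beta> * d = d * \<beta>" and "\<beta> \<noteq> 0"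
    and conj: "j * i = i' * j" and "j \<noteq> 0" and comm: "i * i' = i' * i" and "i \<noteq> i'"
    and no_root: "\<And>t. t * i = i * t \<Longrightarrow> t ^ n \<noteq> \<beta>"
  shows "\<not> amitsur_small TYPE('d)"
proof
  assume small: "amitsur_small TYPE('d)"
  define A where "A s = (if n dvd s then \<beta> ^ (s div n) else 0)" for s
  define u where "u s = A s + j * A (s + 1)" for s
  define \<delta> where "\<delta> = i - i'"
  have d0: "\<delta> \<noteq> 0" using \<open>i \<noteq> i'\<close> by (simp add: \<delta>_def)
  define J where "J = inverse_system_ideal u i"
  let ?x = "var 1 :: (nat \<Rightarrow>\<^sub>0 nat) \<Rightarrow>\<^sub>0 'd" and ?y = "var 2 :: (nat \<Rightarrow>\<^sub>0 nat) \<Rightarrow>\<^sub>0 'd"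
  \<comment> \<open>As \<open>x - i'\<close> kills the component \<open>j b\<close> of \<open>v\<close> and \<open>x - i\<close> kills \<open>1\<close>, the element \<open>\<delta>\<inverse> (x - i')\<close> maps
    \<open>v\<close> to \<open>1\<close>, and \<open>j\<inverse> \<delta>\<inverse> (x - i)\<close> maps \<open>v\<close> to \<open>- b\<close>.  So \<open>?k\<close> maps \<open>v\<close> to
    \<open>y 1 - b = 0\<close>.\<close>
  let ?k = "?y * (const (inverse \<delta>) * (?x - const i')) + const (inverse j * inverse \<delta>) * (?x - const i)"
  have A_central: "A s * d = d * A s" for s d
    using beta_central by (simp add: A_def power_commuting_commutes)
  have A_shift: "A (s + n) = \<beta> * A s" for s
    using \<open>2 \<le> n\<close> by (simp add: A_def)
  have u_shift: "u (s + n) = \<beta> * u s" for s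
    using A_shift[of s] A_shift[of "s + 1"] beta_central[of j]
    by (simp add: u_def distrib_left ac_simps) (metis mult.assoc)
  have u_i': "u s * i - i' * u s = \<delta> * A s" for s
  proof -
    have "u s * i - i' * u s = (A s * i - i' * A s) + (j * (A (s + 1) * i) - i' * j * A (s + 1))"
      by (simp add: u_def algebra_simps)
    also have "A (s + 1) * i = i * A (s + 1)" by (rule A_central)
    also have "j * (i * A (s + 1)) = i' * j * A (s + 1)" using conj by (simp flip: mult.assoc)
    finally show ?thesis by (simp add: A_central[of s i] \<delta>_def algebra_simps)
  qed
  have u_i: "u s * i - i * u s = - \<delta> * j * A (s + 1)" for s
  proof -
    have "u s * i - i * u s = (u s * i - i' * u s) - \<delta> * u s"
      by (simp add: \<delta>_def algebra_simps)
    also have "\<dots> = - \<delta> * j * A (s + 1)" unfolding u_i' by (simp add: u_def algebra_simps)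
    finally show ?thesis .
  qed
  have lin: "pairing u i s (?x - const a) = u s * i - a * u s" for a s
    using pairing_var1_mult[OF one_in_polys, of u i s] by (simp add: pairing_diff pairing_const pairing_one)
  have lin_polys: "?x - const a \<in> polys 1" "?x - const a \<in> polys 2" for a
    by (intro in_polys; simp)+
  have g_J: "(?x - const i) * (?x - const i') \<in> J"
  proof -
    have "pairing u i s ((?x - const i) * (?x - const i')) = 0" for s
    proof -
      have "pairing u i s ((?x - const i) * (?x - const i')) = \<delta> * A s * i - i * (\<delta> * A s)"
        unfolding left_diff_distrib
          pairing_diff[of u i s "?x * (?x - const i')" "const i * (?x - const i')"]
          pairing_var1_mult[OF lin_polys(1)]
          pairing_const_mult[OF lin_polys(1)] lin u_i' ..
      also have "\<dots> = (\<delta> * i - i * \<delta>) * A s"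
        using A_central[of s i] by (simp add: algebra_simps)
      also have "\<dots> = 0" using comm by (simp add: \<delta>_def algebra_simps)
      finally show ?thesis .
    qed
    moreover have "(?x - const i) * (?x - const i') \<in> polys 2"
      by (intro mult_in_polys lin_polys)
    ultimately show ?thesis unfolding J_def inverse_system_ideal_def by blast
  qed
  have k_J: "?k \<in> J"
  proof -
    have "pairing u i s ?k = 0" for s
    proof -
      have "pairing u i s ?k = inverse \<delta> * (\<delta> * A (s + 1)) + inverse j * inverse \<delta> * (- \<delta> * j * A (s + 1))"
        unfolding pairing_add pairing_const_mult[OF lin_polys(1)]
          pairing_var2_mult[OF mult_in_polys[OF const_in_polys lin_polys(1)]] lin u_i u_i' ..
      also have "\<dots> = A (s + 1) - inverse j * (inverse \<delta> * \<delta>) * j * A (s + 1)"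
        using d0 by (simp add: mult.assoc flip: mult.assoc[of "inverse \<delta>" \<delta>])
      also have "\<dots> = 0" using d0 \<open>j \<noteq> 0\<close> by simp
      finally show ?thesis .
    qed
    moreover have "?k \<in> polys 2"
      by (intro in_polys lin_polys) simp_all
    ultimately show ?thesis unfolding J_def inverse_system_ideal_def by blast
  qed
  have "?y ^ n - const \<beta> \<in> polys 2"
    by (intro in_polys) simp_all
  then have y_J: "?y ^ n - const \<beta> \<in> J"
    unfolding J_def inverse_system_ideal_def
    by (simp add: pairing_diff pairing_const pairing_var2_power u_shift)
  have "u 0 = 1" using \<open>2 \<le> n\<close> by (simp add: u_def A_def)
  then have "1 \<notin> J" by (auto simp: J_def inverse_system_ideal_def pairing_one intro!: exI[of _ 0])
  then obtain I where I: "maximal_left_ideal (polys 2) I" and "J \<subseteq> I"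
    using exists_maximal_left_ideal[OF left_ideal_inverse_system _ one_in_polys] unfolding J_def by blast
  then have "maximal_left_ideal (polys 1) (I \<inter> polys 1)"
    using small unfolding amitsur_small_def by force
  moreover have "(?x - const i) * (?x - const i') \<in> I \<inter> polys 1"
    using g_J \<open>J \<subseteq> I\<close> mult_in_polys[OF lin_polys(1) lin_polys(1)] by blast
  ultimately obtain a where a: "?x - const a \<in> I"
    using maximal_left_ideal_contains_linear by blast
  have II: "left_ideal (polys 2) I" and "I \<noteq> polys 2"
    using I by (auto simp: maximal_left_ideal_def)
  have I_mult: "P * Q \<in> I" if "P \<in> polys 2" "Q \<in> I" for P Q
    using II that by (auto simp: left_ideal_def)
  have I_add: "P + Q \<in> I" if "P \<in> I" "Q \<in> I" for P Q
    using II that by (auto simp: left_ideal_def)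
  note I_diff = left_ideal_diff[OF II]
  have "1 \<notin> I"
    using \<open>I \<noteq> polys 2\<close> I_mult[of _ 1] II by (auto simp: left_ideal_def)
  then have const_I: "d = 0" if "const d \<in> I" for d
    using I_mult[OF const_in_polys[of "inverse d"] that] by (cases "d = 0") (auto simp: const_mult)
  \<comment> \<open>Modulo the left ideal generated by \<open>x - a\<close>, the elements of \<open>J\<close> are evaluated at \<open>x = a\<close>.\<close>
  define w where "w = a - i'"
  define e where "e = inverse j * inverse \<delta> * (a - i)"
  have "?k - (?y * const (inverse \<delta>) + const (inverse j * inverse \<delta>)) * (?x - const a) \<in> I"
    by (rule I_diff[OF subsetD[OF \<open>J \<subseteq> I\<close> k_J] I_mult[OF _ a]], intro in_polys) simp_all
  also have "?k - (?y * const (inverse \<delta>) + const (inverse j * inverse \<delta>)) * (?x - const a)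
      = const (inverse \<delta> * w) * ?y + const e"
    by (simp add: w_def e_def algebra_simps const_mult const_diff var_const var_var)
  finally have k': "const (inverse \<delta> * w) * ?y + const e \<in> I" .
  have w0: "w \<noteq> 0"
  proof
    assume "w = 0"
    then have "a = i'" by (simp add: w_def)
    have "e = 0" using k' \<open>w = 0\<close> const_I by simp
    then show False using d0 \<open>j \<noteq> 0\<close> \<open>a = i'\<close> \<open>i \<noteq> i'\<close> by (simp add: e_def)
  qed
  have "(?x - const i) * (?x - const i') - (?x - const i + const w) * (?x - const a) \<in> I"
    by (rule I_diff[OF subsetD[OF \<open>J \<subseteq> I\<close> g_J] I_mult[OF _ a]], intro in_polys) simp_all
  also have "(?x - const i) * (?x - const i') - (?x - const i + const w) * (?x - const a)
      = const (w * a - i * w)"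
    by (simp add: w_def algebra_simps const_mult const_diff const_add var_const)
  finally have wa: "w * a = i * w" using const_I by fastforce
  define q where "q = - (inverse w * \<delta> * e)"
  have "const (inverse w * \<delta>) * (const (inverse \<delta> * w) * ?y + const e) \<in> I"
    using k' by (intro I_mult in_polys)
  also have "const (inverse w * \<delta>) * (const (inverse \<delta> * w) * ?y + const e) = ?y - const q"
  proof -
    have "inverse w * \<delta> * (inverse \<delta> * w) = inverse w * (\<delta> * inverse \<delta>) * w"
      by (simp only: mult.assoc)
    then have "inverse w * \<delta> * (inverse \<delta> * w) = 1" using d0 w0 by simp
    then show ?thesis
      by (simp add: distrib_left const_mult q_def single_uminus)
  qed
  finally have yq: "?y - const q \<in> I" .
  have "(?x - const a) * (?y - const q) - (?y - const q) * (?x - const a) \<in> I"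
    by (rule I_diff[OF I_mult[OF _ yq] I_mult[OF _ a]]; intro in_polys) simp_all
  also have "(?x - const a) * (?y - const q) - (?y - const q) * (?x - const a) = const (a * q - q * a)"
    by (simp add: algebra_simps const_mult const_diff const_add var_const
        var_var[of "Suc 0" 2])
  finally have aq: "a * q = q * a" using const_I by fastforce
  have "?y ^ k - const (q ^ k) \<in> I" for k
  proof (induction k)
    case 0
    then show ?case using II by (simp add: left_ideal_def)
  next
    case (Suc k)
    have "?y * (?y ^ k - const (q ^ k)) + const (q ^ k) * (?y - const q) \<in> I"
      by (rule I_add[OF I_mult[OF _ Suc] I_mult[OF _ yq]]; intro in_polys) simp_all
    then show ?case by (simp add: algebra_simps const_mult var_const power_commutes)
  qed
  then have "(?y ^ n - const \<beta>) - (?y ^ n - const (q ^ n)) \<in> I"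
    by (rule I_diff[OF subsetD[OF \<open>J \<subseteq> I\<close> y_J]])
  then have "const (q ^ n - \<beta>) \<in> I" by (simp add: const_diff)
  then have qn: "q ^ n = \<beta>" using const_I by fastforce
  \<comment> \<open>Conjugation by \<open>w\<close> takes \<open>a\<close> to \<open>i\<close>, hence \<open>q\<close> to a root of \<open>\<beta>\<close> that commutes with \<open>i\<close>.\<close>
  define t where "t = w * q * inverse w"
  have "t * i = w * q * (inverse w * (i * w)) * inverse w" using w0 by (simp add: t_def mult.assoc)
  also have "\<dots> = w * (q * a) * inverse w" using w0 by (simp flip: wa mult.assoc)
  also have "\<dots> = i * t" unfolding aq[symmetric] t_def by (simp add: wa flip: mult.assoc)
  finally have "t * i = i * t" .
  moreover have "t ^ n = \<beta>"
    unfolding t_def power_conj[OF w0] qn beta_central[of w, symmetric]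
    using w0 by (simp add: mult.assoc)
  ultimately show False using no_root by blast
qed

section \<open>Cyclic division algebras of odd prime degree\<close>

theorem theorem3p2:
  fixes scale :: "'f::field \<Rightarrow> 'd::division_ring \<Rightarrow> 'd"
    and p :: nat
  assumes "prime p" and "odd p"
    and "field_algebra scale"
    and "field_algebra.cyclic_algebra scale p"
  shows "\<not> amitsur_small TYPE('d)"
proof -
  interpret field_algebra scale by fact
  obtain i j j' \<tau> \<beta> where gen: "generated_subalgebra {i, j} = UNIV"
    and cyc: "cyclic_galois_extension p (generated_subalgebra {i}) \<tau>"
    and inv: "j * j' = 1"
    and conj: "\<And>t. t \<in> generated_subalgebra {i} \<Longrightarrow> j * t * j' = \<tau> t"
    and beta: "\<beta> \<noteq> 0" "j ^ p = scale \<beta> 1" and central: central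
    and dim: "dim (UNIV :: 'd set) = p\<^sup>2"
    using assms(4) unfolding cyclic_algebra_def by blast
  have j': "j' = inverse j" using inv by (metis inverse_unique)
  have p1: "p > 1" using \<open>prime p\<close> by (rule prime_gt_1_nat)
  \<comment> \<open>Otherwise the algebra would be commutative, equal to its center and of dimension one.\<close>
  have noncomm: "j * i \<noteq> i * j"
  proof
    assume ji: "j * i = i * j"
    have gens: "g * x = x * g" if "g \<in> {i, j}" for g x
      by (rule commutes_with_generated[OF gen]) (use that ji in auto)
    have "x * y = y * x" for x y :: 'd
      by (rule commutes_with_generated[OF gen]) (rule gens[symmetric])
    then have "UNIV \<subseteq> scalars" using central unfolding central_def by blast
    then have "UNIV \<subseteq> span {1 :: 'd}" by (auto simp: scalars_def span_singleton)
    then have "dim (UNIV :: 'd set) \<le> 1"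
      using dim_le_card[of UNIV "{1}"] by simp
    then show False using dim less_1_mult[OF p1 p1] by (simp add: power2_eq_square)
  qed
  interpret cyclic_division_algebra scale p i j \<beta>
  proof
    show "j * t * inverse j \<in> generated_subalgebra {i}" if "t \<in> generated_subalgebra {i}" for t
      using conj[OF that] that cyc j'
      unfolding cyclic_galois_extension_def automorphism_over_def bij_betw_def by auto
    show "extension_field (generated_subalgebra {i})"
      using cyc unfolding cyclic_galois_extension_def galois_extension_def by blast
  qed fact+
  show ?thesis
  proof (rule not_amitsur_smallI[where n = p and \<beta> = "scale \<beta> 1" and i' = "\<sigma> 1 i"])
    show "2 \<le> p" using p1 by simp
    show "scale \<beta> 1 * d = d * scale \<beta> 1" for d by (rule scalar_commutes)
    show "scale \<beta> (1::'d) \<noteq> 0" using beta by simp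
    show "j \<noteq> 0" by (rule j_nonzero)
    then show "j * i = \<sigma> 1 i * j" by (simp add: mult.assoc)
    show "i * \<sigma> 1 i = \<sigma> 1 i * i" by (intro K_comm sigma_in_K i_in_K)
    show "i \<noteq> \<sigma> 1 i" using noncomm \<open>j * i = \<sigma> 1 i * j\<close> by metis
    show "t ^ p \<noteq> scale \<beta> 1" if "t * i = i * t" for t
      using that no_pth_root_in_K[OF \<open>odd p\<close>] centralizer_subset_K by blast
  qed
qed

end
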